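(* For every integer $n\geq1$, $$\gamma(5n+1)+2\gamma(5n+2)+3\gamma(5n+3)+4\gamma(5n+4)\equiv0\pmod5.$$
   Context: A nuclear partition is an integer partition with no part equal to $1$. $\gamma(n)$ denotes the number of nuclear partitions $\mu=(\mu_1,\mu_2,\dots,\mu_r)$ of $n$, with $\mu_1\geq\mu_2\geq\dots\geq\mu_r\geq2$ and $r\geq2$, such that $\mu_1=\mu_2$ (so the two largest parts are equal). *)

theory Defs
  imports "HOL-Number_Theory.Cong"
begin

definition partition_of :: "nat \<Rightarrow> nat list \<Rightarrow> bool" where
  "partition_of n \<mu> \<longleftrightarrow>
     sorted_wrt (\<ge>) \<mu> \<and> (\<forall>k \<in> set \<mu>. k \<ge> 1) \<and> sum_list \<mu> = n"

definition nuclear_partition :: "nat \<Rightarrow> nat list \<Rightarrow> bool" where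
  "nuclear_partition n \<mu> \<longleftrightarrow> partition_of n \<mu> \<and> 1 \<notin> set \<mu>"

definition nuclear_gamma :: "nat \<Rightarrow> nat" where
  "nuclear_gamma n =
     card {\<mu>. nuclear_partition n \<mu> \<and> length \<mu> \<ge> 2 \<and> \<mu> ! 0 = \<mu> ! 1}"

(* The cardinality in nuclear_gamma is that of a finite set. *)
lemma finite_partition_of: "finite {\<mu>. partition_of n \<mu>}"
proof (rule finite_subset)
  have len: "length \<mu> \<le> sum_list \<mu>" if "\<forall>k \<in> set \<mu>. k \<ge> 1" for \<mu> :: "nat list"
    using that by (induction \<mu>) auto
  show "{\<mu>. partition_of n \<mu>} \<subseteq> {\<mu>. set \<mu> \<subseteq> {..n} \<and> length \<mu> \<le> n}"
    using len by (auto simp: partition_of_def member_le_sum_list)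
  show "finite {\<mu>. set \<mu> \<subseteq> {..n} \<and> length \<mu> \<le> n}"
    by (rule finite_lists_length_le) simp
qed

lemma finite_nuclear_gamma:
  "finite {\<mu>. nuclear_partition n \<mu> \<and> length \<mu> \<ge> 2 \<and> \<mu> ! 0 = \<mu> ! 1}"
  by (rule finite_subset[OF _ finite_partition_of[of n]]) (auto simp: nuclear_partition_def)

end

(*
  Away from the smallest cases \<gamma>(n) = p(n) - 2p(n-1) + p(n-2): appending a part 1 and increasing the
  largest part inject partitions of n-1 into those of n. Hence the weighted sum is
  4p(5n+4) - 5p(5n+3) + p(5n-1), and Ramanujan's congruence 5 | p(5n+4) finishes the proof.
  With E = \<Prod>(1 - q^i) the latter follows from 1/E = E^9 / E^10, where E^5 is a series in q^5 modulo 5,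
  and Jacobi's E^3 = \<Sum>(-1)^j (2j+1) q^(j(j+1)/2): an exponent 5n+4 in E^9 comes from odd x, y, z
  with 5 | x^2 + y^2 + z^2, which forces 5 | xyz. Jacobi's identity is obtained modulo q^(N+1) from
  its finite form, so that no infinite products are needed.
*)
theory Submission
  imports Defs "HOL-Computational_Algebra.Formal_Power_Series" "HOL-Library.Nat_Bijection"
begin

section \<open>The function \<gamma> in terms of the partition function\<close>

definition num_partitions :: "nat \<Rightarrow> nat" where
  "num_partitions n = card {\<mu>. partition_of n \<mu>}"

text \<open>Bounding the parts by \<open>N\<close> makes the generating function the inverse of a
  finite product.\<close>

definition bounded_partitions :: "nat \<Rightarrow> nat \<Rightarrow> nat list set" where
  "bounded_partitions N n = {\<mu>. partition_of n \<mu> \<and> (\<forall>k\<in>set \<mu>. k \<le> N)}"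

lemma finite_bounded_partitions: "finite (bounded_partitions N n)"
  by (rule finite_subset[OF _ finite_partition_of[of n]]) (auto simp: bounded_partitions_def)

lemma finite_nuclear_partition: "finite {\<mu>. nuclear_partition n \<mu>}"
  by (rule finite_subset[OF _ finite_partition_of[of n]]) (auto simp: nuclear_partition_def)

lemma card_bounded_partitions_full:
  assumes "n \<le> N"
  shows "card (bounded_partitions N n) = num_partitions n"
proof -
  have "k \<le> N" if "partition_of n \<mu>" "k \<in> set \<mu>" for \<mu> k
    using that assms member_le_sum_list[of k \<mu>] by (auto simp: partition_of_def)
  then have "bounded_partitions N n = {\<mu>. partition_of n \<mu>}"
    by (auto simp: bounded_partitions_def)
  then show ?thesis
    by (simp add: num_partitions_def)
qed

lemma card_bounded_partitions_0: "card (bounded_partitions 0 n) = (if n = 0 then 1 else 0)"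
proof -
  have "bounded_partitions 0 n = (if n = 0 then {[]} else {})"
  proof -
    have "\<mu> = []" if "\<mu> \<in> bounded_partitions 0 n" for \<mu>
      using that by (cases \<mu>) (auto simp: bounded_partitions_def partition_of_def)
    moreover have "[] \<in> bounded_partitions 0 n \<longleftrightarrow> n = 0"
      by (auto simp: bounded_partitions_def partition_of_def)
    ultimately show ?thesis
      by auto
  qed
  then show ?thesis by simp
qed

text \<open>A part \<open>Suc N\<close> is the largest possible, hence the head of the list;
  removing it leaves a partition of \<open>n - Suc N\<close>.\<close>

lemma card_bounded_partitions_Suc:
  "card (bounded_partitions (Suc N) n) =
     card (bounded_partitions N n) +
     (if n < Suc N then 0 else card (bounded_partitions (Suc N) (n - Suc N)))"
proof -
  let ?A = "bounded_partitions N n"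
  let ?B = "if n < Suc N then {} else (#) (Suc N) ` bounded_partitions (Suc N) (n - Suc N)"
  have "\<mu> \<in> ?A \<union> ?B" if \<mu>: "\<mu> \<in> bounded_partitions (Suc N) n" for \<mu>
  proof (cases "Suc N \<in> set \<mu>")
    case True
    then obtain x xs where xs: "\<mu> = x # xs" by (cases \<mu>) auto
    have "x = Suc N"
      using \<mu> True xs by (force simp: bounded_partitions_def partition_of_def)
    then show ?thesis
      using \<mu> xs by (auto simp: bounded_partitions_def partition_of_def)
  next
    case False
    then have "\<forall>k\<in>set \<mu>. k \<le> N"
      using \<mu> by (auto simp: bounded_partitions_def le_Suc_eq)
    then show ?thesis
      using \<mu> by (auto simp: bounded_partitions_def)
  qed
  moreover have "?A \<union> ?B \<subseteq> bounded_partitions (Suc N) n"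
    by (auto simp: bounded_partitions_def partition_of_def)
  ultimately have "bounded_partitions (Suc N) n = ?A \<union> ?B"
    by blast
  moreover have "?A \<inter> ?B = {}"
    by (auto simp: bounded_partitions_def)
  moreover have "card ?B = (if n < Suc N then 0 else card (bounded_partitions (Suc N) (n - Suc N)))"
    by (simp add: card_image)
  ultimately show ?thesis
    using finite_bounded_partitions by (simp add: card_Un_disjoint)
qed

text \<open>If 1 occurs, it is the last entry; dropping that entry is a bijection onto the
  partitions of \<open>n\<close>.\<close>

lemma card_nuclear_partition_Suc:
  "card {\<mu>. nuclear_partition (Suc n) \<mu>} + num_partitions n = num_partitions (Suc n)"
proof -
  let ?A = "{\<mu>. nuclear_partition (Suc n) \<mu>}"
  let ?B = "(\<lambda>\<mu>. \<mu> @ [1]) ` {\<mu>. partition_of n \<mu>}"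
  have "\<mu> \<in> ?A \<union> ?B" if \<mu>: "partition_of (Suc n) \<mu>" for \<mu>
  proof (cases "1 \<in> set \<mu>")
    case True
    then obtain x xs where xs: "\<mu> = xs @ [x]" by (cases \<mu> rule: rev_cases) auto
    have "x = 1"
      using \<mu> True xs by (force simp: partition_of_def sorted_wrt_append)
    then show ?thesis
      using \<mu> xs by (auto simp: partition_of_def sorted_wrt_append)
  qed (use \<mu> in \<open>auto simp: nuclear_partition_def\<close>)
  moreover have "?A \<union> ?B \<subseteq> {\<mu>. partition_of (Suc n) \<mu>}"
    by (auto simp: nuclear_partition_def partition_of_def sorted_wrt_append)
  ultimately have "{\<mu>. partition_of (Suc n) \<mu>} = ?A \<union> ?B"
    by blast
  moreover have "?A \<inter> ?B = {}"
    by (auto simp: nuclear_partition_def)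
  moreover have "card ?B = num_partitions n"
    by (simp add: card_image inj_on_def num_partitions_def)
  ultimately show ?thesis
    using finite_nuclear_partition finite_partition_of
    by (simp add: card_Un_disjoint num_partitions_def[of "Suc n"])
qed

text \<open>Raising the largest part by 1 is a bijection from the nuclear partitions of
  \<open>n\<close> to those of \<open>Suc n\<close> whose largest part is not repeated. The bound on
  \<open>n\<close> excludes the empty list, which has no largest part, and \<open>[2]\<close>, which
  would be lowered to \<open>[1]\<close>.\<close>

lemma nuclear_gamma_Suc:
  assumes "n \<ge> 2"
  shows "nuclear_gamma (Suc n) + card {\<mu>. nuclear_partition n \<mu>} =
         card {\<mu>. nuclear_partition (Suc n) \<mu>}"
proof -
  let ?A = "{\<mu>. nuclear_partition (Suc n) \<mu> \<and> length \<mu> \<ge> 2 \<and> \<mu> ! 0 = \<mu> ! 1}"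
  let ?f = "\<lambda>\<mu>. Suc (hd \<mu>) # tl \<mu>"
  let ?B = "?f ` {\<mu>. nuclear_partition n \<mu>}"
  have ne: "\<mu> \<noteq> []" if "nuclear_partition n \<mu>" for \<mu>
    using that assms by (auto simp: nuclear_partition_def partition_of_def)
  have "\<mu> \<in> ?A \<union> ?B" if \<mu>: "nuclear_partition (Suc n) \<mu>" for \<mu>
  proof (cases "length \<mu> \<ge> 2 \<and> \<mu> ! 0 = \<mu> ! 1")
    case False
    obtain x xs where xs: "\<mu> = x # xs"
      using \<mu> by (cases \<mu>) (auto simp: nuclear_partition_def partition_of_def)
    \<comment> \<open>The head can thus be lowered: it stays at least 2 and no smaller than the
      other parts.\<close>
    have "x \<ge> 3 \<and> (\<forall>k\<in>set xs. k < x)"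
    proof (cases xs)
      case Nil
      then show ?thesis
        using \<mu> xs assms by (auto simp: nuclear_partition_def partition_of_def)
    next
      case (Cons y ys)
      then have "y < x" "y \<ge> 2" "\<forall>k\<in>set ys. k \<le> y"
        using \<mu> xs False by (auto simp: nuclear_partition_def partition_of_def)
      then show ?thesis
        using Cons by auto
    qed
    then have "nuclear_partition n ((x - 1) # xs)"
      using \<mu> xs by (fastforce simp: nuclear_partition_def partition_of_def)
    moreover have "\<mu> = ?f ((x - 1) # xs)"
      using \<open>x \<ge> 3 \<and> _\<close> xs by simp
    ultimately show ?thesis by blast
  qed (use \<mu> in auto)
  moreover have "?f \<mu> \<in> {\<mu>. nuclear_partition (Suc n) \<mu>} - ?A" if \<mu>: "nuclear_partition n \<mu>" for \<mu>
  proof -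
    obtain x xs where xs: "\<mu> = x # xs" using ne[OF \<mu>] by (cases \<mu>) auto
    have "xs ! 0 \<le> x" if "xs \<noteq> []"
      using \<mu> xs that by (auto simp: nuclear_partition_def partition_of_def)
    then have "?f \<mu> \<notin> ?A"
      using xs by (cases xs) auto
    then show ?thesis
      using \<mu> xs by (auto simp: nuclear_partition_def partition_of_def)
  qed
  ultimately have eq: "{\<mu>. nuclear_partition (Suc n) \<mu>} = ?A \<union> ?B" and disj: "?A \<inter> ?B = {}"
    by blast+
  have "card {\<mu>. nuclear_partition (Suc n) \<mu>} = card ?A + card ?B"
    unfolding eq by (rule card_Un_disjoint[OF _ _ disj])
      (simp_all only: finite_nuclear_gamma finite_imageI finite_nuclear_partition)
  moreover have "inj_on ?f {\<mu>. nuclear_partition n \<mu>}"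
    by (rule inj_onI) (metis list.inject list.collapse mem_Collect_eq nat.inject ne)
  then have "card ?B = card {\<mu>. nuclear_partition n \<mu>}"
    by (rule card_image)
  ultimately show ?thesis
    by (simp only: nuclear_gamma_def)
qed

lemma nuclear_gamma_eq_second_difference:
  assumes "n \<ge> 1"
  shows "int (nuclear_gamma (n + 2)) =
    int (num_partitions (n + 2)) - 2 * int (num_partitions (n + 1)) + int (num_partitions n)"
  using nuclear_gamma_Suc[of "n + 1"] card_nuclear_partition_Suc[of n]
    card_nuclear_partition_Suc[of "n + 1"] assms by simp

section \<open>Jacobi's identity for the cube of the Euler product\<close>

definition euler_prod :: "nat \<Rightarrow> int fps" where
  "euler_prod N = (\<Prod>i<N. 1 - fps_X ^ Suc i)"

lemma euler_prod_0 [simp]: "euler_prod 0 = 1"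
  and euler_prod_Suc: "euler_prod (Suc N) = euler_prod N * (1 - fps_X ^ Suc N)"
  by (simp_all add: euler_prod_def)

definition partition_fps :: "nat \<Rightarrow> int fps" where
  "partition_fps N = Abs_fps (\<lambda>n. int (card (bounded_partitions N n)))"

lemma partition_fps_Suc: "partition_fps (Suc N) * (1 - fps_X ^ Suc N) = partition_fps N"
proof -
  have "partition_fps (Suc N) = partition_fps N + fps_X ^ Suc N * partition_fps (Suc N)"
    by (rule fps_ext)
      (simp add: partition_fps_def card_bounded_partitions_Suc fps_X_power_mult_nth del: power_Suc)
  then show ?thesis
    by (simp add: algebra_simps)
qed

text \<open>The factors cancel one by one by \<open>partition_fps_Suc\<close>. Multiplying by
  \<open>partition_fps N\<close> will replace division by \<open>euler_prod N\<close>.\<close>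

lemma partition_fps_mult_euler_prod: "partition_fps N * euler_prod N = 1"
proof (induction N)
  case 0
  show ?case
    by (rule fps_ext) (simp add: partition_fps_def card_bounded_partitions_0)
next
  case (Suc N)
  have "partition_fps (Suc N) * euler_prod (Suc N) =
        partition_fps (Suc N) * (1 - fps_X ^ Suc N) * euler_prod N"
    by (simp only: euler_prod_Suc mult_ac)
  then show ?case
    by (simp only: partition_fps_Suc Suc)
qed

text \<open>The additional factors \<open>1 - q^i\<close> have \<open>i > m\<close>, so each is 1
  modulo \<open>q^(m+1)\<close>.\<close>

lemma euler_prod_cong:
  assumes "m \<le> n"
  shows "fps_X ^ Suc m dvd euler_prod n - euler_prod m"
  using assms
proof (induction n rule: dec_induct)
  case (step n)
  have "fps_X ^ Suc m dvd (fps_X ^ Suc n :: int fps)"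
    using step.hyps by (intro le_imp_power_dvd) simp
  moreover have "euler_prod (Suc n) - euler_prod m =
      (euler_prod n - euler_prod m) - euler_prod n * fps_X ^ Suc n"
    by (simp add: euler_prod_Suc algebra_simps)
  ultimately show ?case
    using step.IH by (metis dvd_diff dvd_mult)
qed simp

lemma euler_prod_mult_partition_fps_cong:
  assumes "m \<le> n"
  shows "\<exists>h. euler_prod n * partition_fps m = 1 + fps_X ^ Suc m * h"
proof -
  obtain h where h: "euler_prod n - euler_prod m = fps_X ^ Suc m * h"
    using euler_prod_cong[OF assms] by (auto elim: dvdE)
  have "euler_prod n * partition_fps m =
      partition_fps m * euler_prod m + (euler_prod n - euler_prod m) * partition_fps m"
    by (simp add: algebra_simps)
  also have "\<dots> = 1 + fps_X ^ Suc m * (h * partition_fps m)"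
    by (simp only: h partition_fps_mult_euler_prod mult.assoc)
  finally show ?thesis ..
qed

text \<open>
  \<open>theta_coeff N j\<close> is the common coefficient of \<open>z^(-j)\<close> and \<open>z^(j+1)\<close> in the finite triple product
  \<open>(1 + z) (\<Prod>i=1..N. (1 + z q^i) (1 + q^i / z))\<close>; the recursion multiplies by \<open>(1 + z q^(N+1)) (1 + q^(N+1) / z)\<close>.
  The truncated subtraction \<open>0 - 1 = 0\<close> implements the symmetry \<open>j \<mapsto> -1 - j\<close>.
\<close>
fun theta_coeff :: "nat \<Rightarrow> nat \<Rightarrow> int fps" where
  "theta_coeff 0 j = (if j = 0 then 1 else 0)"
| "theta_coeff (Suc N) j = (1 + fps_X ^ (2 * N + 2)) * theta_coeff N j
     + fps_X ^ (N + 1) * (theta_coeff N (j - 1) + theta_coeff N (j + 1))"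

lemma theta_coeff_eq_0: "j > N \<Longrightarrow> theta_coeff N j = 0"
  by (induction N arbitrary: j) auto

lemma theta_coeff_diag: "theta_coeff N N = fps_X ^ triangle N"
  by (induction N) (simp_all add: theta_coeff_eq_0 flip: power_add add: add_ac)

text \<open>With \<open>N = m + j\<close>, this says that \<open>theta_coeff N j\<close> is
  \<open>q^(triangle j)\<close> times the Gaussian binomial coefficient of \<open>2N+1\<close> over
  \<open>N-j\<close>, with denominators cleared.\<close>

lemma theta_coeff_closed_form:
  "theta_coeff (m + j) j * (euler_prod m * euler_prod (m + 2 * j + 1)) =
     fps_X ^ triangle j * euler_prod (2 * (m + j) + 1)"
proof (induction "m + j" arbitrary: m j)
  case 0
  then show ?case by simp
next
  case (Suc N m j)
  show ?case
  proof (cases m)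
    case 0
    then show ?thesis by (simp add: theta_coeff_diag)
  next
    case m: (Suc k)
    have N: "N = k + j" using Suc.hyps(2) m by simp
    \<comment> \<open>In these abbreviations each term of the recursion, multiplied by
      \<open>E\<close>, is \<open>t * Q\<close> times a polynomial in \<open>q\<close>,
      \<open>u\<close>, \<open>w\<close>.\<close>
    define q :: "int fps" where "q = fps_X"
    define Q where "Q = euler_prod (2 * N + 1)"
    define t where "t = q ^ triangle j"
    define E where "E = euler_prod m * euler_prod (m + 2 * j + 1)"
    define u where "u = q ^ k"
    define w where "w = q ^ (k + 2 * j + 1)"
    have Pm: "euler_prod m = euler_prod k * (1 - q * u)"
      by (simp add: m euler_prod_Suc q_def u_def)
    have Pl: "euler_prod (m + 2 * j + 1) = euler_prod (k + 2 * j + 1) * (1 - q * w)"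
      by (simp add: m euler_prod_Suc q_def w_def)
    have F1: "theta_coeff N j * E = (1 - q * u) * (1 - q * w) * t * Q"
    proof -
      have "theta_coeff N j * (euler_prod k * euler_prod (k + 2 * j + 1)) = t * Q"
        using Suc.hyps(1)[OF N] by (simp add: N t_def q_def Q_def)
      then show ?thesis
        unfolding E_def Pm Pl by algebra
    qed
    have F2: "q ^ (N + 1) * theta_coeff N (j - 1) * E = q * u * (1 - w) * (1 - q * w) * t * Q"
    \<comment> \<open>For \<open>j = 0\<close> the truncated index turns the claim into
      \<open>F1\<close>, because \<open>w = q * u\<close>.\<close>
    proof (cases j)
      case 0
      have "w = q * u" "q ^ (N + 1) = q * u"
        by (simp_all add: w_def u_def 0 N)
      then show ?thesis
        using F1 by (simp only: 0 diff_0_eq_0 mult.assoc)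
    next
      case (Suc i)
      have IH: "theta_coeff N i * (euler_prod m * euler_prod (m + 2 * i + 1)) = q ^ triangle i * Q"
        using Suc.hyps(1)[of m i] by (simp add: N m Suc q_def Q_def)
      have E: "E = euler_prod m * (euler_prod (m + 2 * i + 1) * (1 - w) * (1 - q * w))"
        unfolding E_def Pl by (simp add: Suc m euler_prod_Suc w_def q_def)
      have pw: "q ^ (N + 1) * q ^ triangle i = q * u * t"
        by (simp add: N Suc u_def t_def power_add)
      have "q ^ (N + 1) * theta_coeff N (j - 1) * E = q ^ (N + 1) *
          (theta_coeff N i * (euler_prod m * euler_prod (m + 2 * i + 1))) * ((1 - w) * (1 - q * w))"
        unfolding E Suc diff_Suc_1 by (simp only: mult_ac)
      also have "\<dots> = q ^ (N + 1) * q ^ triangle i * Q * ((1 - w) * (1 - q * w))"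
        unfolding IH by (simp only: mult_ac)
      finally show ?thesis
        unfolding pw by (simp only: mult_ac)
    qed
    have F3: "q ^ (N + 1) * theta_coeff N (j + 1) * E = q * w * (1 - u) * (1 - q * u) * t * Q"
    \<comment> \<open>For \<open>k = 0\<close> both sides vanish: \<open>j + 1 > N\<close> on the
      left and \<open>u = 1\<close> on the right.\<close>
    proof (cases k)
      case 0
      then show ?thesis by (simp add: theta_coeff_eq_0 N u_def)
    next
      case (Suc i)
      have IH: "theta_coeff N (j + 1) * (euler_prod i * euler_prod (m + 2 * j + 1)) =
            q ^ triangle (j + 1) * Q"
        using Suc.hyps(1)[of i "j + 1"] by (simp add: N m Suc q_def Q_def)
      have Pk: "euler_prod k = euler_prod i * (1 - u)"
        by (simp add: Suc euler_prod_Suc u_def q_def)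
      have pw: "q ^ (N + 1) * q ^ triangle (j + 1) = q * w * t"
        by (simp add: N w_def t_def power_add mult_2)
      have "q ^ (N + 1) * theta_coeff N (j + 1) * E = q ^ (N + 1) *
          (theta_coeff N (j + 1) * (euler_prod i * euler_prod (m + 2 * j + 1))) *
          ((1 - u) * (1 - q * u))"
        unfolding E_def Pm Pk by (simp only: mult_ac)
      also have "\<dots> = q ^ (N + 1) * q ^ triangle (j + 1) * Q * ((1 - u) * (1 - q * u))"
        unfolding IH by (simp only: mult_ac)
      finally show ?thesis
        unfolding pw by (simp only: mult_ac)
    qed
    have a1: "q ^ (2 * N + 2) = q * u * w"
      by (simp add: N u_def w_def mult_2 power_add)
    have a2: "q ^ (2 * N + 3) = q * q * u * w"
      by (simp add: N u_def w_def mult_2 power_add numeral_3_eq_3)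
    have "theta_coeff (Suc N) j * E = (1 + q * u * w) * (theta_coeff N j * E)
        + q ^ (N + 1) * theta_coeff N (j - 1) * E + q ^ (N + 1) * theta_coeff N (j + 1) * E"
      unfolding theta_coeff.simps q_def[symmetric] a1 by (simp add: algebra_simps)
    also have "\<dots> = t * (Q * (1 - q * u * w) * (1 - q * q * u * w))"
      unfolding F1 F2 F3 by algebra
    \<comment> \<open>The two new factors are those of \<open>euler_prod\<close> at
      \<open>2N+2\<close> and \<open>2N+3\<close>.\<close>
    also have "Q * (1 - q * u * w) * (1 - q * q * u * w) = euler_prod (2 * (m + j) + 1)"
      unfolding a1[symmetric] a2[symmetric] using N m
      by (simp add: Q_def euler_prod_Suc q_def numeral_3_eq_3)
    finally show ?thesis
      unfolding E_def t_def q_def Suc.hyps(2)[symmetric] .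
  qed
qed

text \<open>By the closed form the product is \<open>q^(triangle j)\<close> times two quotients of
  Euler products, both 1 modulo \<open>q^(m+1)\<close> for \<open>m = N - j\<close>. As
  \<open>j \<le> triangle j\<close>, the error starts at \<open>q^(N+1)\<close> or later.\<close>

lemma theta_coeff_cong:
  assumes "j \<le> N"
  shows "fps_X ^ Suc N dvd euler_prod N * theta_coeff N j - fps_X ^ triangle j"
proof -
  obtain m where N: "N = m + j"
    using assms by (metis le_add_diff_inverse2)
  obtain g where g: "euler_prod (2 * N + 1) * partition_fps (m + 2 * j + 1) =
      1 + fps_X ^ Suc (m + 2 * j + 1) * g"
    using euler_prod_mult_partition_fps_cong[of "m + 2 * j + 1" "2 * N + 1"] N by auto
  obtain h where h: "euler_prod N * partition_fps m = 1 + fps_X ^ Suc m * h"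
    using euler_prod_mult_partition_fps_cong[of m N] N by auto
  \<comment> \<open>The surplus power goes into \<open>?a\<close>, so that both errors carry the
    same factor \<open>q^(m+1)\<close>.\<close>
  let ?a = "fps_X ^ (2 * j + 1) * g"
  have "euler_prod N * theta_coeff N j =
      euler_prod N * theta_coeff N j * (partition_fps m * euler_prod m) *
      (partition_fps (m + 2 * j + 1) * euler_prod (m + 2 * j + 1))"
    by (simp add: partition_fps_mult_euler_prod)
  also have "\<dots> = euler_prod N * partition_fps m * partition_fps (m + 2 * j + 1) *
      (theta_coeff N j * (euler_prod m * euler_prod (m + 2 * j + 1)))"
    by (simp only: mult_ac)
  also have "\<dots> = (euler_prod N * partition_fps m) * fps_X ^ triangle j *
      (euler_prod (2 * N + 1) * partition_fps (m + 2 * j + 1))"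
    unfolding N theta_coeff_closed_form by (simp only: mult_ac)
  also have "\<dots> = fps_X ^ triangle j * (1 + fps_X ^ Suc m * h) * (1 + fps_X ^ Suc m * ?a)"
    unfolding g h by (simp add: power_add mult_ac)
  also have "\<dots> - fps_X ^ triangle j =
      fps_X ^ (triangle j + Suc m) * (h + ?a + fps_X ^ Suc m * h * ?a)"
    by (simp only: power_add) algebra
  finally have "fps_X ^ (triangle j + Suc m) dvd
      euler_prod N * theta_coeff N j - fps_X ^ triangle j"
    by simp
  moreover have "j \<le> triangle j"
    by (cases j) simp_all
  ultimately show ?thesis
    by (elim dvd_trans[rotated]) (simp add: N le_imp_power_dvd)
qed

text \<open>The derivative of \<open>z^(-j) + z^(j+1)\<close> at \<open>z = -1\<close>.\<close>

definition jacobi_coeff :: "nat \<Rightarrow> int" where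
  "jacobi_coeff j = (- 1) ^ j * (2 * int j + 1)"

text \<open>Shifting indices reduces this to \<open>c(j-1) + c(j+1) = -2 c(j)\<close> for the
  coefficients \<open>c\<close>. At \<open>j = 0\<close> the truncated index supplies the missing
  term, since the formula gives \<open>c(-1) = 1 = c(0)\<close>.\<close>

lemma sum_jacobi_coeff_neighbours:
  fixes g :: "nat \<Rightarrow> 'a :: comm_ring_1"
  shows "(\<Sum>j\<le>M. of_int (jacobi_coeff j) * (g (j - 1) + g (j + 1))) =
    - 2 * (\<Sum>j\<le>M. of_int (jacobi_coeff j) * g j)
    + of_int (jacobi_coeff M) * g (M + 1) - of_int (jacobi_coeff (M + 1)) * g M"
  by (induction M) (simp_all add: jacobi_coeff_def algebra_simps)

text \<open>Both sides are the derivative of the finite triple product at \<open>z = -1\<close>.\<close>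
lemma sum_theta_coeff:
  "(\<Sum>j\<le>N. of_int (jacobi_coeff j) * theta_coeff N j) = euler_prod N ^ 2"
proof (induction N)
  case 0
  then show ?case by (simp add: jacobi_coeff_def)
next
  case (Suc N)
  let ?q = "fps_X ^ (N + 1) :: int fps"
  let ?S = "\<Sum>j\<le>N. of_int (jacobi_coeff j) * theta_coeff N j"
  have S: "(\<Sum>j\<le>Suc N. of_int (jacobi_coeff j) * theta_coeff N j) = ?S"
    by (simp add: theta_coeff_eq_0)
  have q2: "fps_X ^ (2 * N + 2) = ?q ^ 2"
    by (simp only: power_mult[symmetric]) simp
  have "(\<Sum>j\<le>Suc N. of_int (jacobi_coeff j) * theta_coeff (Suc N) j) =
      (1 + ?q ^ 2) * (\<Sum>j\<le>Suc N. of_int (jacobi_coeff j) * theta_coeff N j) +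
      ?q * (\<Sum>j\<le>Suc N. of_int (jacobi_coeff j) * (theta_coeff N (j - 1) + theta_coeff N (j + 1)))"
    unfolding theta_coeff.simps q2 sum_distrib_left sum.distrib[symmetric]
    by (intro sum.cong refl) algebra
  \<comment> \<open>The boundary terms vanish, since \<open>theta_coeff N\<close> is zero at
    \<open>N+1\<close> and \<open>N+2\<close>.\<close>
  also have "\<dots> = (1 + ?q ^ 2) * ?S + ?q * (- 2 * ?S)"
    unfolding sum_jacobi_coeff_neighbours S by (simp add: theta_coeff_eq_0)
  also have "\<dots> = (1 - ?q) ^ 2 * ?S"
    by algebra
  finally show ?case
    unfolding Suc by (simp add: euler_prod_Suc power_mult_distrib mult.commute)
qed

lemma euler_prod_cube_cong:
  "fps_X ^ Suc N dvd
     euler_prod N ^ 3 - (\<Sum>j\<le>N. of_int (jacobi_coeff j) * fps_X ^ triangle j)"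
proof -
  have "euler_prod N ^ 3 - (\<Sum>j\<le>N. of_int (jacobi_coeff j) * fps_X ^ triangle j) =
      euler_prod N * euler_prod N ^ 2 - (\<Sum>j\<le>N. of_int (jacobi_coeff j) * fps_X ^ triangle j)"
    by (simp add: power3_eq_cube power2_eq_square)
  also have "\<dots> = (\<Sum>j\<le>N. of_int (jacobi_coeff j) *
      (euler_prod N * theta_coeff N j - fps_X ^ triangle j))"
    unfolding sum_theta_coeff[symmetric] sum_distrib_left sum_subtractf[symmetric]
    by (intro sum.cong refl) algebra
  also have "fps_X ^ Suc N dvd \<dots>"
    by (intro dvd_sum dvd_mult theta_coeff_cong) simp
  finally show ?thesis .
qed

section \<open>Ramanujan's congruence modulo 5\<close>

lemma fps_nth_eq_of_X_power_dvd:
  fixes f g :: "'a :: comm_ring_1 fps"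
  assumes "fps_X ^ k dvd f - g" "n < k"
  shows "fps_nth f n = fps_nth g n"
proof -
  obtain h where "f - g = fps_X ^ k * h"
    using assms(1) by (rule dvdE)
  then have "fps_nth (f - g) n = 0"
    using assms(2) by (simp add: fps_X_power_mult_nth)
  then show ?thesis by simp
qed

text \<open>Nonzero squares are 1 or -1 modulo 5, and three such signs sum to an odd number of
  absolute value at most 3.\<close>

lemma sum_three_squares_dvd_5:
  fixes x y z :: int
  assumes "5 dvd x ^ 2 + y ^ 2 + z ^ 2"
  shows "5 dvd x * y * z"
proof -
  have sq: "5 dvd a \<or> a ^ 2 mod 5 = 1 \<or> a ^ 2 mod 5 = 4" for a :: int
  proof -
    have "a mod 5 \<in> {0, 1, 2, 3, 4}"
      by auto
    then show ?thesis
      by (auto simp: dvd_eq_mod_eq_0 power2_eq_square mod_mult_eq[symmetric, of a a])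
  qed
  show ?thesis
  proof (rule ccontr)
    assume "\<not> 5 dvd x * y * z"
    then have "\<not> 5 dvd x" "\<not> 5 dvd y" "\<not> 5 dvd z"
      by auto
    with sq[of x] sq[of y] sq[of z] assms show False
      by presburger
  qed
qed

lemma jacobi_coeff_prod_dvd_5:
  assumes "(triangle a + triangle b + triangle c) mod 5 = 4"
  shows "5 dvd jacobi_coeff a * jacobi_coeff b * jacobi_coeff c"
proof -
  have T: "8 * int (triangle a) + 1 = (2 * int a + 1) ^ 2" for a
    by (induction a) (simp_all add: power2_eq_square algebra_simps)
  have "(2 * int a + 1) ^ 2 + (2 * int b + 1) ^ 2 + (2 * int c + 1) ^ 2 =
      8 * int (triangle a + triangle b + triangle c) + 3"
    using T[of a] T[of b] T[of c] by simp
  \<comment> \<open>A triangular sum congruent to 4 gives \<open>8 * 4 + 3 = 35\<close>.\<close>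
  also have "5 dvd \<dots>"
    using assms by presburger
  finally have "5 dvd (2 * int a + 1) * (2 * int b + 1) * (2 * int c + 1)"
    by (rule sum_three_squares_dvd_5)
  then have "5 dvd (2 * int a + 1) * (2 * int b + 1) * (2 * int c + 1) * (- 1) ^ (a + b + c)"
    by (rule dvd_mult2)
  then show ?thesis
    by (simp add: jacobi_coeff_def power_add mult_ac)
qed

lemma euler_prod_power_9_nth:
  assumes "5 * n + 4 \<le> N"
  shows "5 dvd fps_nth (euler_prod N ^ 9) (5 * n + 4)"
proof -
  let ?J = "\<Sum>j\<le>N. of_int (jacobi_coeff j) * fps_X ^ triangle j :: int fps"
  have "euler_prod N ^ 3 - ?J dvd (euler_prod N ^ 3) ^ 3 - ?J ^ 3"
    unfolding power_diff_sumr2[of _ 3] by simp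
  then have "fps_X ^ Suc N dvd (euler_prod N ^ 3) ^ 3 - ?J ^ 3"
    using euler_prod_cube_cong dvd_trans by blast
  then have "fps_nth (euler_prod N ^ 9) (5 * n + 4) = fps_nth (?J ^ 3) (5 * n + 4)"
    using assms fps_nth_eq_of_X_power_dvd[of "Suc N" "(euler_prod N ^ 3) ^ 3" "?J ^ 3" "5 * n + 4"]
    by (simp flip: power_mult)
  also have "?J ^ 3 = (\<Sum>a\<le>N. \<Sum>b\<le>N. \<Sum>c\<le>N.
      of_int (jacobi_coeff a * jacobi_coeff b * jacobi_coeff c) *
      fps_X ^ (triangle a + triangle b + triangle c))"
    unfolding power3_eq_cube sum_product sum_distrib_right sum_distrib_left
    by (intro sum.cong refl) (simp add: power_add mult_ac)
  also have "5 dvd fps_nth \<dots> (5 * n + 4)"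
    unfolding fps_sum_nth
  proof (intro dvd_sum)
    fix a b c
    show "5 dvd fps_nth (of_int (jacobi_coeff a * jacobi_coeff b * jacobi_coeff c) *
        fps_X ^ (triangle a + triangle b + triangle c) :: int fps) (5 * n + 4)"
    proof (cases "triangle a + triangle b + triangle c = 5 * n + 4")
      case True
      then have "5 dvd jacobi_coeff a * jacobi_coeff b * jacobi_coeff c"
        by (intro jacobi_coeff_prod_dvd_5) simp
      then show ?thesis
        by (simp add: fps_X_power_mult_right_nth flip: fps_of_int)
    next
      case False
      then show ?thesis
        by (auto simp: fps_X_power_mult_right_nth simp flip: fps_of_int of_int_mult)
    qed
  qed
  finally show ?thesis .
qed

text \<open>Modulo 5, \<open>(1 - x)^5\<close> is \<open>1 - x^5\<close>; \<open>R\<close> collects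
  these factors and is a series in \<open>q^5\<close>.\<close>

lemma euler_prod_power_5:
  "\<exists>R h. euler_prod N ^ 5 = R + 5 * h \<and> fps_nth R 0 = 1 \<and> (\<forall>i. \<not> 5 dvd i \<longrightarrow> fps_nth R i = 0)"
proof (induction N)
  case 0
  show ?case
    by (rule exI[of _ 1], rule exI[of _ 0]) (auto intro: Nat.gr0I)
next
  case (Suc N)
  then obtain R h where R: "euler_prod N ^ 5 = R + 5 * h" "fps_nth R 0 = 1"
      "\<And>i. \<not> 5 dvd i \<Longrightarrow> fps_nth R i = 0"
    by auto
  let ?x = "fps_X ^ Suc N :: int fps"
  \<comment> \<open>The inner binomial terms of \<open>(1 - x)^5\<close>, divided by 5.\<close>
  let ?e = "- ?x + 2 * ?x ^ 2 - 2 * ?x ^ 3 + ?x ^ 4"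
  let ?R = "R * (1 - ?x ^ 5)"
  have "(1 - ?x) ^ 5 = 1 - ?x ^ 5 + 5 * ?e"
    by algebra
  then have "euler_prod (Suc N) ^ 5 = (R + 5 * h) * (1 - ?x ^ 5 + 5 * ?e)"
    unfolding euler_prod_Suc power_mult_distrib R(1) by simp
  also have "\<dots> = ?R + 5 * (h * (1 - ?x ^ 5) + (R + 5 * h) * ?e)"
    by algebra
  finally have "euler_prod (Suc N) ^ 5 = ?R + 5 * (h * (1 - ?x ^ 5) + (R + 5 * h) * ?e)" .
  moreover have nth: "fps_nth ?R i =
      fps_nth R i - (if i < 5 * Suc N then 0 else fps_nth R (i - 5 * Suc N))" for i
    by (simp add: right_diff_distrib fps_X_power_mult_right_nth mult.commute
        flip: power_mult del: power_Suc mult_Suc mult_Suc_right)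
  moreover have "fps_nth ?R 0 = 1"
    unfolding nth using R(2) by simp
  moreover have "fps_nth ?R i = 0" if "\<not> 5 dvd i" for i
  proof -
    have "\<not> 5 dvd i - 5 * Suc N" if "\<not> i < 5 * Suc N"
      using \<open>\<not> 5 dvd i\<close> that by (metis dvd_diffD dvd_triv_left not_less)
    then show ?thesis
      unfolding nth using R(3) that by simp
  qed
  ultimately show ?case by blast
qed

theorem num_partitions_dvd_5: "5 dvd num_partitions (5 * n + 4)"
proof -
  define N where "N = 5 * n + 4"
  obtain R h where R: "euler_prod N ^ 5 = R + 5 * h" "fps_nth R 0 = 1"
      "\<And>i. \<not> 5 dvd i \<Longrightarrow> fps_nth R i = 0"
    using euler_prod_power_5 by blast
  \<comment> \<open>Modulo 5, \<open>R ^ 2\<close> represents the tenth power of the Euler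
    product.\<close>
  define r where "r = fps_nth (R ^ 2)"
  have r0: "r 0 = 1"
    by (simp add: r_def R(2) power2_eq_square)
  have r: "r i = 0" if "\<not> 5 dvd i" for i
  proof -
    have "fps_nth R k * fps_nth R (i - k) = 0" if "k \<le> i" for k
      using R(3)[of k] R(3)[of "i - k"] \<open>\<not> 5 dvd i\<close> that
      by (metis dvd_diffD mult_eq_0_iff)
    then show ?thesis
      unfolding r_def power2_eq_square fps_mult_nth by (intro sum.neutral) simp
  qed
  have "euler_prod N ^ 9 = partition_fps N * euler_prod N * euler_prod N ^ 9"
    by (simp add: partition_fps_mult_euler_prod)
  also have "\<dots> = partition_fps N * (euler_prod N ^ 5) ^ 2"
    by algebra
  also have "\<dots> = partition_fps N * R ^ 2 + 5 * (partition_fps N * (2 * R * h + 5 * h ^ 2))"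
    unfolding R(1) by algebra
  finally have eq: "euler_prod N ^ 9 =
      partition_fps N * R ^ 2 + fps_const 5 * (partition_fps N * (2 * R * h + 5 * h ^ 2))"
    by (simp add: numeral_fps_const)
  have *: "5 dvd fps_nth (partition_fps N * R ^ 2) (5 * m + 4)" if "m \<le> n" for m
  proof -
    have "5 dvd fps_nth (euler_prod N ^ 9) (5 * m + 4)"
      using that by (intro euler_prod_power_9_nth) (simp add: N_def)
    then show ?thesis
      unfolding eq by (simp add: dvd_add_left_iff)
  qed
  have "5 dvd fps_nth (partition_fps N) (5 * m + 4)" if "m \<le> n" for m
    using that
  \<comment> \<open>Since \<open>r 0 = 1\<close>, the convolution with \<open>r\<close> can be
    solved for the coefficient at \<open>5 * m + 4\<close>. The other nonzero \<open>r i\<close>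
    have \<open>5 dvd i\<close>, so they meet only earlier coefficients in the same residue
    class.\<close>
  proof (induction m rule: less_induct)
    case (less m)
    let ?f = "\<lambda>i. r i * fps_nth (partition_fps N) (5 * m + 4 - i)"
    have "fps_nth (partition_fps N * R ^ 2) (5 * m + 4) = (\<Sum>i=0..5 * m + 4. ?f i)"
      unfolding mult.commute[of "partition_fps N"] fps_mult_nth r_def ..
    also have "\<dots> = ?f 0 + (\<Sum>i=Suc 0..5 * m + 4. ?f i)"
      by (rule sum.atLeast_Suc_atMost) simp
    finally have "fps_nth (partition_fps N) (5 * m + 4) =
        fps_nth (partition_fps N * R ^ 2) (5 * m + 4) - (\<Sum>i=Suc 0..5 * m + 4. ?f i)"
      using r0 by simp
    moreover have "5 dvd ?f i" if i: "i \<in> {Suc 0..5 * m + 4}" for i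
    proof (cases "5 dvd i")
      case True
      then obtain k where k: "i = 5 * k" by (rule dvdE)
      then have "5 dvd fps_nth (partition_fps N) (5 * (m - k) + 4)"
        using i less.prems by (intro less.IH) auto
      moreover have "5 * (m - k) + 4 = 5 * m + 4 - i"
        using k i by auto
      ultimately show ?thesis by simp
    qed (simp add: r)
    ultimately show ?case
      using *[OF less.prems] by (simp only: dvd_diff dvd_sum)
  qed
  \<comment> \<open>The index \<open>5 * n + 4\<close> is \<open>N\<close> itself, so the bound on
    the parts excludes no partition.\<close>
  from this[of n] have "5 dvd int (card (bounded_partitions N N))"
    by (simp add: partition_fps_def N_def)
  then show ?thesis
    by (simp add: card_bounded_partitions_full N_def int_dvd_int_iff[of 5, simplified])
qed

section \<open>The weighted sum of values of \<gamma>\<close>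

theorem mainTheorem8:
  fixes n :: nat
  assumes "n \<ge> 1"
  shows "[nuclear_gamma (5 * n + 1) + 2 * nuclear_gamma (5 * n + 2)
          + 3 * nuclear_gamma (5 * n + 3) + 4 * nuclear_gamma (5 * n + 4) = 0] (mod 5)"
proof -
  \<comment> \<open>The shift turns the index \<open>5n - 1\<close> into \<open>5 * m + 4\<close>,
    without subtraction.\<close>
  obtain m where n: "n = Suc m" using assms by (cases n) auto
  let ?p = "\<lambda>k. int (num_partitions (5 * m + k))"
  have g: "int (nuclear_gamma (5 * n + k)) = ?p (k + 5) - 2 * ?p (k + 4) + ?p (k + 3)" for k
    using nuclear_gamma_eq_second_difference[of "5 * m + k + 3"] n by (simp add: add_ac)
  \<comment> \<open>The weights 1, 2, 3, 4 are linear, so the second differences cancel except at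
    the ends.\<close>
  have "int (nuclear_gamma (5 * n + 1) + 2 * nuclear_gamma (5 * n + 2)
          + 3 * nuclear_gamma (5 * n + 3) + 4 * nuclear_gamma (5 * n + 4)) =
        4 * ?p 9 - 5 * ?p 8 + ?p 4"
    using g[of 1] g[of 2] g[of 3] g[of 4] by simp
  moreover have "5 dvd ?p 9"
    using num_partitions_dvd_5[of n] n by (simp add: add_ac int_dvd_int_iff[of 5, simplified])
  moreover have "5 dvd ?p 4"
    using num_partitions_dvd_5[of m] by (simp add: int_dvd_int_iff[of 5, simplified])
  ultimately have "5 dvd int (nuclear_gamma (5 * n + 1) + 2 * nuclear_gamma (5 * n + 2)
          + 3 * nuclear_gamma (5 * n + 3) + 4 * nuclear_gamma (5 * n + 4))"
    by (simp add: dvd_add)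
  then show ?thesis
    by (simp only: cong_0_iff int_dvd_int_iff[of 5, simplified])
qed

end
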